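(* Let $H = Z_n$ be a finite cyclic group of order $n > 1$, and assume that $m\text{-}G(H)$ is connected for some integer $m > 1$. Let $k = \gcd(m,n)$ and $a \in Z_n$. Then: (1) $\deg(0) = k-1$. (2) If $a \neq 0$ and $k \nmid a$ in $\mathbb{Z}$, then $\deg(a) = 1$. (3) If $a \neq 0$ and $k \mid a$ in $\mathbb{Z}$, then $\deg(a) = k+1$. Here $\deg$ denotes the degree in the graph $m\text{-}G(H)$.
   Context: $Z_n$ is the additive cyclic group of integers modulo $n$, with elements represented by the integers $0,1,\dots,n-1$; divisibility "in $\mathbb{Z}$" refers to these representatives. For an integer $m>1$, the graph $m\text{-}G(Z_n)$ is the simple undirected graph with vertex set $Z_n$ in which two distinct vertices $a,b$ are adjacent if and only if $ma=b$ or $mb=a$ in $Z_n$. *)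

theory Defs
  imports "HOL-Algebra.Elementary_Groups" "Graph_Theory.Graph_Theory"
begin

text \<open>
  The graph $m$-$G(H)$ of a group $H$. As usual in \<^theory>\<open>Graph_Theory.Graph_Theory\<close>,
  a simple undirected graph is a loop-free symmetric digraph without parallel arcs
  (locale \<^locale>\<open>graph\<close>); each edge is represented by both of its orientations.
  HOL-Algebra writes groups multiplicatively, so the additive multiple $ma$ is the power of
  \<open>a\<close> with exponent \<open>m\<close>.
\<close>
definition m_graph :: "nat \<Rightarrow> ('a, 'b) monoid_scheme \<Rightarrow> ('a, 'a \<times> 'a) pre_digraph" where
  "m_graph m H = with_proj
     \<lparr> pverts = carrier H,
       parcs = {(a, b). a \<in> carrier H \<and> b \<in> carrier H \<and> a \<noteq> b
                  \<and> (a [^]\<^bsub>H\<^esub> m = b \<or> b [^]\<^bsub>H\<^esub> m = a)} \<rparr>"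

lemma graph_m_graph:
  assumes "finite (carrier H)"
  shows "graph (m_graph m H)"
proof -
  let ?A = "{(a, b). a \<in> carrier H \<and> b \<in> carrier H \<and> a \<noteq> b
              \<and> (a [^]\<^bsub>H\<^esub> m = b \<or> b [^]\<^bsub>H\<^esub> m = a)}"
  have "?A \<subseteq> carrier H \<times> carrier H"
    by auto
  then have "finite ?A"
    using assms by (meson finite_SigmaI finite_subset)
  moreover have "sym ?A"
    by (auto simp: sym_def)
  ultimately show ?thesis
    unfolding m_graph_def
    by unfold_locales (auto simp: assms symmetric_def arc_to_ends_def)
qed

text \<open>
  The degree of a vertex in such a graph is its \<^const>\<open>out_degree\<close>: the arcs leaving a
  vertex correspond to its neighbours.
\<close>
lemma out_degree_m_graph:
  "out_degree (m_graph m H) a = card {b. a \<rightarrow>\<^bsub>m_graph m H\<^esub> b}"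
proof -
  have "out_arcs (m_graph m H) a = Pair a ` {b. a \<rightarrow>\<^bsub>m_graph m H\<^esub> b}"
    by (auto simp: m_graph_def out_arcs_def)
  then show ?thesis
    by (simp add: out_degree_def card_image inj_on_def)
qed

end

theory Submission
  imports Defs "HOL-Number_Theory.Cong"
begin

text \<open>
  Draw an arc from every element of a group to its \<open>m\<close>-th power; the graph is what is left after
  forgetting directions and loops. Connectedness makes this functional graph a tree hanging from the
  identity: along an edge the property that some iterated \<open>m\<close>-th power is the identity is
  passed on in both directions, so it spreads from the identity to the whole group. Hence the
  only cycle of the power map is the loop at the identity. A vertex \<open>x\<close> other than the identity
  therefore has exactly one neighbour towards the root, its power, and all its \<open>m\<close>-th roots
  as further neighbours, none of which coincides with \<open>x\<close> or with that power. At the identity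
  the power is a loop and one of the roots is the identity itself.

  It remains to count roots in the integers modulo \<open>n\<close>, where they are the solutions \<open>b\<close> of
  \<open>[m * b = a] (mod n)\<close>: there are \<open>gcd m n\<close> of them if \<open>gcd m n\<close> divides \<open>a\<close>, and none otherwise.
\<close>

lemma dominates_m_graph_iff:
  "a \<rightarrow>\<^bsub>m_graph m H\<^esub> b \<longleftrightarrow> a \<in> carrier H \<and> b \<in> carrier H \<and> a \<noteq> b
     \<and> (a [^]\<^bsub>H\<^esub> m = b \<or> b [^]\<^bsub>H\<^esub> m = a)"
  by (auto simp: m_graph_def)

text \<open>
  If \<open>b = a [^] m\<close>, then \<open>b [^] (m ^ r)\<close> is \<open>a [^] (m ^ Suc r)\<close>, so the number of iterations that
  leads one end of an edge to the identity needs to grow by at most one for the other end.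
  Induction along a walk from the identity to \<open>x\<close> then gives the claim.
\<close>
lemma (in group) connected_m_graph_imp_pow_eq_one:
  assumes "Digraph_Component.connected (m_graph m G)" and "x \<in> carrier G"
  shows "\<exists>r. x [^] (m ^ r) = \<one>"
proof -
  let ?S = "with_proj (mk_symmetric (m_graph m G))"
  have "\<one> \<rightarrow>\<^sup>*\<^bsub>?S\<^esub> x"
    using assms by (auto simp: connected_def strongly_connected_def m_graph_def)
  then show ?thesis
    unfolding reachable_def
  proof (induction rule: rtrancl_on_induct)
    case base
    show ?case by simp
  next
    case (step y z)
    then obtain r where r: "y [^] (m ^ r) = \<one>" by blast
    have yz: "y \<in> carrier G" "z \<in> carrier G" "y [^] m = z \<or> z [^] m = y"
      using step.hyps by (auto simp: parcs_mk_symmetric m_graph_def)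
    from yz(3) show ?case
    proof
      assume "y [^] m = z"
      then have "z [^] (m ^ r) = (y [^] (m ^ r)) [^] m"
        using yz(1) by (simp add: nat_pow_pow mult.commute flip: \<open>y [^] m = z\<close>)
      then show ?thesis using r by auto
    next
      assume "z [^] m = y"
      then have "z [^] (m ^ Suc r) = \<one>"
        using r yz(2) by (simp add: nat_pow_pow flip: \<open>z [^] m = y\<close>)
      then show ?thesis by blast
    qed
  qed
qed

text \<open>
  Taking \<open>m\<close>-th powers \<open>2 * r\<close> times leads to or past the point where \<open>x\<close> becomes the identity, but
  returns to \<open>x\<close> if two steps do. Since a fixed point of the power map is also fixed by two steps, this
  excludes both loops and pairs of opposite arcs away from the identity.
\<close>
lemma (in group) pow_square_fixed_imp_one:
  fixes m r :: nat
  assumes "x [^] (m ^ r) = \<one>" and "x \<in> carrier G" and "x [^] (m * m) = x"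
  shows "x = \<one>"
proof -
  have "x [^] ((m * m) ^ s) = x" for s
  proof (induction s)
    case 0
    show ?case using assms(2) by simp
  next
    case (Suc s)
    then show ?case using assms(2,3) by (metis nat_pow_pow power_Suc)
  qed
  moreover have "x [^] ((m * m) ^ r) = \<one>"
    using assms(1,2) by (metis nat_pow_pow nat_pow_one power_mult_distrib)
  ultimately show ?thesis by simp
qed

lemma (in group) out_degree_m_graph_one:
  "out_degree (m_graph m G) \<one> = card {y \<in> carrier G. y [^] m = \<one>} - 1"
proof -
  have "{y. \<one> \<rightarrow>\<^bsub>m_graph m G\<^esub> y} = {y \<in> carrier G. y [^] m = \<one>} - {\<one>}"
    by (auto simp: dominates_m_graph_iff)
  then show ?thesis
    by (simp add: out_degree_m_graph)
qed

text \<open>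
  The neighbours are the power of \<open>x\<close> and its roots. Excluding cycles of length two keeps the power from
  being counted among the roots, and excluding loops keeps \<open>x\<close> itself out of both.
\<close>
lemma (in group) out_degree_m_graph_nonidentity:
  assumes "finite (carrier G)" and "Digraph_Component.connected (m_graph m G)"
    and x: "x \<in> carrier G" "x \<noteq> \<one>"
  shows "out_degree (m_graph m G) x = card {y \<in> carrier G. y [^] m = x} + 1"
proof -
  have no_2_cycle: "(x [^] m) [^] m \<noteq> x"
    using connected_m_graph_imp_pow_eq_one[OF assms(2) x(1)] pow_square_fixed_imp_one x
    by (metis nat_pow_pow)
  then have no_loop: "x [^] m \<noteq> x"
    by auto
  then have "{y. x \<rightarrow>\<^bsub>m_graph m G\<^esub> y} = insert (x [^] m) {y \<in> carrier G. y [^] m = x}"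
    using x by (auto simp: dominates_m_graph_iff)
  then show ?thesis
    using no_2_cycle assms(1) by (simp add: out_degree_m_graph)
qed

text \<open>
  Both sides of a solvable congruence agree modulo \<open>k\<close>, so \<open>k\<close> divides \<open>a\<close>. In that case dividing
  \<open>m\<close>, \<open>a\<close> and \<open>n\<close> by \<open>k\<close> makes the coefficient invertible, so the solutions form a single residue class modulo \<open>n div k\<close>; this class meets
  \<open>{0..<n}\<close> in \<open>k\<close> points.
\<close>
lemma card_linear_congruence_solutions:
  fixes n m k :: nat and a :: int
  assumes "n > 0" and k: "k = gcd m n"
  shows "card {b \<in> {0..<int n}. [int m * b = a] (mod int n)} = (if int k dvd a then k else 0)"
proof (cases "int k dvd a")
  case False
  have "int k dvd a" if "[int m * b = a] (mod int n)" for b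
  proof -
    have "int k dvd int n" "int k dvd int m * b"
      by (simp_all add: k)
    then show ?thesis
      using that by (metis cong_dvd_iff cong_dvd_modulus)
  qed
  with False show ?thesis by (auto simp: card_eq_0_iff)
next
  case True
  have k0: "k > 0" using assms by simp
  obtain m' n' where m': "m = k * m'" and n': "n = k * n'" and cop: "coprime m' n'"
    using gcd_coprime_exists[of m n] assms by (metis gcd_eq_0_iff less_numeral_extra(3) mult.commute)
  obtain a' where a': "a = int k * a'" using True by blast
  have n'0: "n' > 0" using assms(1) n' by simp
  have copi: "coprime (int m') (int n')" using cop by simp
  obtain u where u: "[int m' * u = 1] (mod int n')"
    using cong_solve_coprime_int[OF copi] by blast
  \<comment> \<open>The unique solution modulo \<open>n'\<close>, as \<open>u\<close> inverts \<open>m'\<close>.\<close>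
  define c where "c = (u * a') mod int n'"
  have "[int m' * c = int m' * (u * a')] (mod int n')"
    unfolding c_def by (simp add: cong_def mod_mult_right_eq)
  moreover have "[int m' * (u * a') = a'] (mod int n')"
    using cong_mult[OF u cong_refl[of a']] by (simp add: mult.assoc)
  ultimately have c: "[int m' * c = a'] (mod int n')" by (rule cong_trans)
  have c_range: "0 \<le> c" "c < int n'"
    using n'0 by (simp_all add: c_def)
  have iff: "[int m * b = a] (mod int n) \<longleftrightarrow> b mod int n' = c" for b
  proof -
    have "[int m * b = a] (mod int n) \<longleftrightarrow> int k * int n' dvd int k * (int m' * b - a')"
      by (simp add: cong_iff_dvd_diff m' n' a' algebra_simps)
    also have "\<dots> \<longleftrightarrow> [int m' * b = a'] (mod int n')"
      using k0 by (simp add: cong_iff_dvd_diff)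
    also have "\<dots> \<longleftrightarrow> [int m' * b = int m' * c] (mod int n')"
      using c cong_sym cong_trans by blast
    also have "\<dots> \<longleftrightarrow> b mod int n' = c"
      using copi c_range by (simp add: cong_mult_lcancel) (simp add: cong_def)
    finally show ?thesis .
  qed
  have "{b \<in> {0..<int n}. b mod int n' = c} = (\<lambda>q. q * int n' + c) ` {0..<int k}"
  proof (intro equalityI subsetI)
    fix b assume b: "b \<in> {b \<in> {0..<int n}. b mod int n' = c}"
    then have "b div int n' * int n' + c = b"
      by auto
    moreover have "b < int k * int n'"
      using b by (simp add: n')
    ultimately have "b div int n' * int n' < int k * int n'"
      using c_range by linarith
    then have "b div int n' \<in> {0..<int k}"
      using b n'0 by (simp add: pos_imp_zdiv_nonneg_iff)
    with \<open>b div int n' * int n' + c = b\<close> show "b \<in> (\<lambda>q. q * int n' + c) ` {0..<int k}"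
      by (metis image_eqI)
  next
    fix b assume "b \<in> (\<lambda>q. q * int n' + c) ` {0..<int k}"
    then obtain q where q: "0 \<le> q" "q + 1 \<le> int k" "b = q * int n' + c" by auto
    have "(q + 1) * int n' \<le> int k * int n'"
      using q(2) by (intro mult_right_mono) auto
    then have "b < int n"
      using c_range q(3) by (simp add: n' algebra_simps)
    with q c_range show "b \<in> {b \<in> {0..<int n}. b mod int n' = c}" by simp
  qed
  moreover have "inj_on (\<lambda>q. q * int n' + c) {0..<int k}"
    using n'0 by (auto simp: inj_on_def)
  ultimately show ?thesis
    using True by (simp add: iff card_image)
qed

lemma card_roots_integer_mod_group:
  fixes n m :: nat and a :: int
  assumes "n > 0" and "a \<in> carrier (integer_mod_group n)"
  shows "card {b \<in> carrier (integer_mod_group n). b [^]\<^bsub>integer_mod_group n\<^esub> m = a}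
    = (if int (gcd m n) dvd a then gcd m n else 0)"
proof -
  have "{b \<in> carrier (integer_mod_group n). b [^]\<^bsub>integer_mod_group n\<^esub> m = a}
      = {b \<in> {0..<int n}. [int m * b = a] (mod int n)}"
    using assms by (auto simp: carrier_integer_mod_group cong_def)
  then show ?thesis
    using card_linear_congruence_solutions[OF assms(1) refl] by simp
qed

theorem theorem3p1:
  fixes n m k :: nat and a :: int
  assumes "n > 1" and "m > 1"
    and "Digraph_Component.connected (m_graph m (integer_mod_group n))"
    and "k = gcd m n"
    and "a \<in> carrier (integer_mod_group n)"
  shows "out_degree (m_graph m (integer_mod_group n)) 0 = k - 1
    \<and> (a \<noteq> 0 \<and> \<not> int k dvd a \<longrightarrow> out_degree (m_graph m (integer_mod_group n)) a = 1)
    \<and> (a \<noteq> 0 \<and> int k dvd a \<longrightarrow> out_degree (m_graph m (integer_mod_group n)) a = k + 1)"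
proof -
  let ?Z = "integer_mod_group n"
  interpret Z: group ?Z by simp
  have n: "n > 0" and fin: "finite (carrier ?Z)"
    using assms(1) by (simp_all add: carrier_integer_mod_group)
  show ?thesis
    using Z.out_degree_m_graph_one[of m]
      Z.out_degree_m_graph_nonidentity[OF fin assms(3,5)]
      card_roots_integer_mod_group[OF n integer_mod_group_0, of m]
      card_roots_integer_mod_group[OF n assms(5), of m]
    by (simp add: assms(4))
qed

end
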